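(* Every edge-coloured graph $G$ satisfies $t_{\mathrm{inj}}(C_6^A,G)\leq (1/2)^6+o(1)$, where $o(1)$ denotes a quantity tending to $0$ as $v(G)\to\infty$; that is, for every $\varepsilon>0$ there exists $n_0$ such that every edge-coloured graph $G$ with $v(G)\geq n_0$ satisfies $t_{\mathrm{inj}}(C_6^A,G)\leq (1/2)^6+\varepsilon$.
   Context: An edge-coloured graph is a (finite, simple) graph each of whose edges is coloured either red or blue. The alternating $6$-cycle $C_6^A$ is the edge-coloured graph consisting of the cycle $C_6$ in which every vertex is incident to exactly one red edge and exactly one blue edge. A homomorphism from an edge-coloured graph $H$ to an edge-coloured graph $G$ is a map $f:V(H)\to V(G)$ such that whenever $uv$ is an edge of $H$, $f(u)f(v)$ is an edge of $G$ of the same colour as $uv$. For edge-coloured graphs $H,G$ with $v(G)\geq v(H)$, let $\hom_{\mathrm{inj}}(H,G)$ be the number of injective homomorphisms from $H$ to $G$, and set $\hom_{\mathrm{inj}}(H,G):=0$ if $v(G)<v(H)$. Define $t_{\mathrm{inj}}(H,G):=\frac{(v(G)-v(H))!}{v(G)!}\hom_{\mathrm{inj}}(H,G)$, i.e. the probability that a uniformly random injective map $V(H)\to V(G)$ is a homomorphism (and $0$ if $v(G)<v(H)$). *)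

theory Defs
  imports Complex_Main "HOL-Library.FuncSet"
begin

datatype colour = Red | Blue

text \<open>Edges are two-element vertex sets. The function \<open>col\<close> is total, but only its values on
  edges matter: no definition below inspects it elsewhere.\<close>

record 'a ecgraph =
  verts :: "'a set"
  edges :: "'a set set"
  col :: "'a set \<Rightarrow> colour"

definition edge_coloured_graph :: "'a ecgraph \<Rightarrow> bool" where
  "edge_coloured_graph G \<longleftrightarrow>
     finite (verts G) \<and> (\<forall>e\<in>edges G. e \<subseteq> verts G \<and> card e = 2)"

definition order :: "'a ecgraph \<Rightarrow> nat" where
  "order G = card (verts G)"

text \<open>Homomorphisms are extensional functions on \<open>verts H\<close>, so that each map of vertex sets is
  counted once.\<close>

definition homs :: "'a ecgraph \<Rightarrow> 'b ecgraph \<Rightarrow> ('a \<Rightarrow> 'b) set" where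
  "homs H G = {f \<in> verts H \<rightarrow>\<^sub>E verts G.
     \<forall>u v. {u, v} \<in> edges H \<longrightarrow>
       {f u, f v} \<in> edges G \<and> col G {f u, f v} = col H {u, v}}"

definition hom_inj :: "'a ecgraph \<Rightarrow> 'b ecgraph \<Rightarrow> nat" where
  "hom_inj H G =
     (if order G < order H then 0 else card {f \<in> homs H G. inj_on f (verts H)})"

definition t_inj :: "'a ecgraph \<Rightarrow> 'b ecgraph \<Rightarrow> real" where
  "t_inj H G = fact (order G - order H) / fact (order G) * real (hom_inj H G)"

definition C6A :: "nat ecgraph" where
  "C6A = \<lparr> verts = {..<6},
           edges = {{i, (i + 1) mod 6} | i. i < 6},
           col = (\<lambda>e. if e \<in> {{0, 1}, {2, 3}, {4, 5}} then Red else Blue) \<rparr>"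

lemma C6A_edges: "edges C6A = {{0, 1}, {1, 2}, {2, 3}, {3, 4}, {4, 5}, {5, 0}}"
proof -
  have "edges C6A = (\<lambda>i. {i, (i + 1) mod 6}) ` {..<6}"
    by (auto simp: C6A_def)
  also have "{..<6} = {0, 1, 2, 3, 4, 5 :: nat}"
    by auto
  finally show ?thesis
    by (simp del: One_nat_def)
qed

lemma edge_coloured_graph_C6A: "edge_coloured_graph C6A"
  unfolding edge_coloured_graph_def C6A_edges by (auto simp: C6A_def)

lemma C6A_alternating:
  assumes "v \<in> verts C6A"
  shows "\<exists>!e. e \<in> edges C6A \<and> v \<in> e \<and> col C6A e = c"
proof -
  have v: "v = 0 \<or> v = 1 \<or> v = 2 \<or> v = 3 \<or> v = 4 \<or> v = 5"
    using assms by (auto simp: C6A_def)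
  have col: "col C6A {0, 1} = Red" "col C6A {2, 3} = Red" "col C6A {4, 5} = Red"
      "col C6A {1, 2} = Blue" "col C6A {3, 4} = Blue" "col C6A {5, 0} = Blue"
    by (simp_all add: C6A_def doubleton_eq_iff)
  have "\<exists>e\<in>edges C6A. (v \<in> e \<and> col C6A e = c) \<and>
      (\<forall>e'\<in>edges C6A. v \<in> e' \<and> col C6A e' = c \<longrightarrow> e' = e)"
    unfolding C6A_edges bex_simps ball_simps col
    using v by (cases c) (elim disjE; simp)+
  then show ?thesis
    by blast
qed

end

theory Submission
  imports Defs "HOL-Analysis.Convex" "HOL-Real_Asymp.Real_Asymp"
begin

text \<open>Give red pairs the value \<open>1\<close> and all other pairs, including the diagonal, the value \<open>-1\<close>;
  let \<open>S\<close> be the resulting symmetric matrix and \<open>J\<close> the all-ones matrix. Up to the factor \<open>64\<close>, the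
  injective homomorphisms are bounded by the trace of \<open>M^3\<close>, where \<open>M = (J + S)(J - S)\<close>. With
  \<open>d = S1\<close> we have \<open>M = a b\<^sup>T - K\<close> for \<open>a = n + d\<close>, \<open>b = 1 - d/n\<close> and the positive
  semidefinite matrix \<open>K = S\<^sup>2 - d d\<^sup>T / n\<close>. Since \<open>\<bar>S\<bar> \<le> 1\<close> entrywise,
  \<open>tr K \<le> n\<^sup>2 - \<bar>d\<bar>\<^sup>2 / n = b \<bullet> a\<close>. This bounds the operator norm of \<open>K\<close> by \<open>b \<bullet> a\<close>,
  which absorbs every term of \<open>tr M^3\<close> of uncertain sign except one that depends on \<open>K d\<close>
  alone; completing a square handles that one and leaves \<open>tr M^3 \<le> n^6\<close>.\<close>

section \<open>Traces of cubes and Gram matrices\<close>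

text \<open>\<open>M^3\<close> expands into eight words in the rank-one matrix and \<open>K\<close>.
  Each rank-one factor cuts the cycle of a trace into scalars b^T K^j a, so the words agree in
  groups of 1, 3, 3 and 1; symmetry of \<open>K\<close> turns b^T K^2 a into the inner product of K
  b and K a.\<close>

lemma trace_cube_rank_one_minus:
  fixes K :: "'a \<Rightarrow> 'a \<Rightarrow> real" and a b :: "'a \<Rightarrow> real" and V :: "'a set"
  assumes sym: "\<And>x y. K x y = K y x"
  defines "M \<equiv> \<lambda>x y. a x * b y - K x y"
  defines "C \<equiv> \<Sum>x\<in>V. b x * a x"
  defines "mv \<equiv> \<lambda>f x. \<Sum>y\<in>V. K x y * f y"
  shows "(\<Sum>x\<in>V. \<Sum>y\<in>V. \<Sum>z\<in>V. M x y * M y z * M z x) =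
    C ^ 3 - 3 * C * (\<Sum>x\<in>V. b x * mv a x) + 3 * (\<Sum>x\<in>V. mv b x * mv a x)
      - (\<Sum>x\<in>V. \<Sum>y\<in>V. \<Sum>z\<in>V. K x y * K y z * K z x)"
proof -
  let ?Q = "\<Sum>x\<in>V. b x * mv a x" and ?W = "\<Sum>x\<in>V. mv b x * mv a x"
  have Cs: "(\<Sum>x\<in>V. b x * a x) = C" "(\<Sum>x\<in>V. a x * b x) = C"
    by (simp_all add: C_def mult.commute)
  have mvs: "(\<Sum>y\<in>V. K x y * f y) = mv f x" for f x
    by (simp add: mv_def)
  have adj: "(\<Sum>x\<in>V. f x * mv g x) = (\<Sum>x\<in>V. mv f x * g x)" for f g
  proof -
    have "(\<Sum>x\<in>V. f x * mv g x) = (\<Sum>x\<in>V. \<Sum>y\<in>V. f x * (K x y * g y))"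
      by (simp add: mv_def sum_distrib_left)
    also have "\<dots> = (\<Sum>y\<in>V. \<Sum>x\<in>V. f x * (K x y * g y))"
      by (rule sum.swap)
    also have "\<dots> = (\<Sum>x\<in>V. mv f x * g x)"
      by (simp add: mv_def sum_distrib_left sum_distrib_right sym mult_ac)
    finally show ?thesis .
  qed
  have step: "(\<Sum>z\<in>V. M y z * M z x) =
      C * a y * b x - a y * mv b x - mv a y * b x + (\<Sum>z\<in>V. K y z * K z x)" for x y
    by (simp add: M_def C_def mv_def algebra_simps sum.distrib sum_subtractf
        sum_distrib_left sum_distrib_right sym[of _ x])
  have "(\<Sum>x\<in>V. \<Sum>y\<in>V. \<Sum>z\<in>V. M x y * M y z * M z x) =
      (\<Sum>x\<in>V. \<Sum>y\<in>V. M x y * (\<Sum>z\<in>V. M y z * M z x))"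
    by (simp add: sum_distrib_left mult_ac)
  also have "\<dots> = (\<Sum>x\<in>V. \<Sum>y\<in>V.
      C * (a x * b x) * (b y * a y) - a x * mv b x * (b y * a y) - a x * b x * (b y * mv a y)
      + a x * b y * (\<Sum>z\<in>V. K y z * K z x) - C * (b x * (K x y * a y)) + mv b x * (K x y * a y)
      + b x * (K x y * mv a y) - (\<Sum>z\<in>V. K x y * K y z * K z x))"
    unfolding step by (simp add: M_def algebra_simps sum_distrib_left sum_subtractf)
  also have "\<dots> = C * C * C - (\<Sum>x\<in>V. a x * mv b x) * C - C * ?Q
      + (\<Sum>x\<in>V. \<Sum>y\<in>V. a x * b y * (\<Sum>z\<in>V. K y z * K z x)) - C * ?Q + ?W
      + (\<Sum>x\<in>V. b x * mv (mv a) x) - (\<Sum>x\<in>V. \<Sum>y\<in>V. \<Sum>z\<in>V. K x y * K y z * K z x)"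
    by (simp add: sum.distrib sum_subtractf Cs mvs flip: sum_distrib_left sum_distrib_right)
  also have "(\<Sum>x\<in>V. \<Sum>y\<in>V. a x * b y * (\<Sum>z\<in>V. K y z * K z x)) = (\<Sum>x\<in>V. a x * mv (mv b) x)"
  proof (rule sum.cong[OF refl])
    fix x
    have "(\<Sum>y\<in>V. a x * b y * (\<Sum>z\<in>V. K y z * K z x))
        = a x * (\<Sum>y\<in>V. \<Sum>z\<in>V. K x z * (K z y * b y))"
      by (simp add: sum_distrib_left sym mult_ac)
    also have "(\<Sum>y\<in>V. \<Sum>z\<in>V. K x z * (K z y * b y)) = (\<Sum>z\<in>V. \<Sum>y\<in>V. K x z * (K z y * b y))"
      by (rule sum.swap)
    finally show "(\<Sum>y\<in>V. a x * b y * (\<Sum>z\<in>V. K y z * K z x)) = a x * mv (mv b) x"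
      by (simp add: mv_def sum_distrib_left)
  qed
  also have "\<dots> = ?W"
    by (simp add: adj[of a "mv b"] mult_ac)
  also have "(\<Sum>x\<in>V. b x * mv (mv a) x) = ?W"
    by (rule adj)
  also have "(\<Sum>x\<in>V. a x * mv b x) = ?Q"
    by (simp add: adj[of a b] mult_ac)
  finally show ?thesis
    by (simp add: power3_eq_cube algebra_simps)
qed

text \<open>Since K = L^T L, the diagonal entry of K^3 at \<open>x\<close> is the squared norm of
  column \<open>x\<close> of L K.\<close>

lemma trace_cube_gram_nonneg:
  fixes V :: "'a set" and L :: "'a \<Rightarrow> 'a \<Rightarrow> real"
  defines "K \<equiv> \<lambda>x y. \<Sum>z\<in>V. L z x * L z y"
  shows "0 \<le> (\<Sum>x\<in>V. \<Sum>y\<in>V. \<Sum>z\<in>V. K x y * K y z * K z x)"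
proof -
  have "(\<Sum>y\<in>V. \<Sum>z\<in>V. K x y * K y z * K z x) = (\<Sum>w\<in>V. (\<Sum>y\<in>V. L w y * K y x)\<^sup>2)" for x
  proof -
    have "K x y * K y z * K z x = (\<Sum>w\<in>V. (L w y * K y x) * (L w z * K z x))" for y z
    proof -
      have "K x y = K y x"
        by (simp add: K_def mult_ac)
      moreover have "K y z = (\<Sum>w\<in>V. L w y * L w z)"
        by (simp add: K_def)
      ultimately show ?thesis
        by (simp only: sum_distrib_left sum_distrib_right mult_ac)
    qed
    then have "(\<Sum>y\<in>V. \<Sum>z\<in>V. K x y * K y z * K z x)
        = (\<Sum>y\<in>V. \<Sum>z\<in>V. \<Sum>w\<in>V. (L w y * K y x) * (L w z * K z x))"
      by simp
    also have "\<dots> = (\<Sum>y\<in>V. \<Sum>w\<in>V. \<Sum>z\<in>V. (L w y * K y x) * (L w z * K z x))"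
      by (intro sum.cong refl sum.swap)
    also have "\<dots> = (\<Sum>w\<in>V. \<Sum>y\<in>V. \<Sum>z\<in>V. (L w y * K y x) * (L w z * K z x))"
      by (rule sum.swap)
    also have "\<dots> = (\<Sum>w\<in>V. (\<Sum>y\<in>V. L w y * K y x)\<^sup>2)"
      by (simp add: power2_eq_square sum_product)
    finally show ?thesis .
  qed
  then show ?thesis
    by (simp add: sum_nonneg)
qed

text \<open>This is K^2 \<le> (tr K) K as quadratic forms. With \<open>l\<close> = L f, the form f^T
  K f is |l|^2 and K f = L^T l; Cauchy-Schwarz in each coordinate costs the squared Frobenius norm
  of \<open>L\<close>, which is tr K.\<close>

lemma gram_mult_norm_le:
  fixes V :: "'a set" and L :: "'a \<Rightarrow> 'a \<Rightarrow> real" and f :: "'a \<Rightarrow> real"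
  defines "K \<equiv> \<lambda>x y. \<Sum>z\<in>V. L z x * L z y"
  defines "mv \<equiv> \<lambda>x. \<Sum>y\<in>V. K x y * f y"
  shows "(\<Sum>x\<in>V. (mv x)\<^sup>2) \<le> (\<Sum>x\<in>V. K x x) * (\<Sum>x\<in>V. f x * mv x)"
    and "0 \<le> (\<Sum>x\<in>V. f x * mv x)"
proof -
  define l where "l z = (\<Sum>y\<in>V. L z y * f y)" for z
  have mv: "mv x = (\<Sum>z\<in>V. L z x * l z)" for x
  proof -
    have "mv x = (\<Sum>y\<in>V. \<Sum>z\<in>V. L z x * (L z y * f y))"
      by (simp add: mv_def K_def sum_distrib_left sum_distrib_right mult_ac)
    also have "\<dots> = (\<Sum>z\<in>V. \<Sum>y\<in>V. L z x * (L z y * f y))"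
      by (rule sum.swap)
    finally show ?thesis
      by (simp add: l_def sum_distrib_left)
  qed
  have "(\<Sum>x\<in>V. f x * mv x) = (\<Sum>x\<in>V. \<Sum>z\<in>V. f x * (L z x * l z))"
    by (simp add: mv sum_distrib_left)
  also have "\<dots> = (\<Sum>z\<in>V. \<Sum>x\<in>V. f x * (L z x * l z))"
    by (rule sum.swap)
  also have "\<dots> = (\<Sum>z\<in>V. (l z)\<^sup>2)"
    unfolding power2_eq_square by (subst (3) l_def) (simp add: sum_distrib_left sum_distrib_right mult_ac)
  finally have quad: "(\<Sum>x\<in>V. f x * mv x) = (\<Sum>z\<in>V. (l z)\<^sup>2)" .
  then show "0 \<le> (\<Sum>x\<in>V. f x * mv x)"
    by (simp add: sum_nonneg)
  have "(\<Sum>x\<in>V. (mv x)\<^sup>2) \<le> (\<Sum>x\<in>V. (\<Sum>z\<in>V. (L z x)\<^sup>2) * (\<Sum>z\<in>V. (l z)\<^sup>2))"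
    unfolding mv by (intro sum_mono Cauchy_Schwarz_ineq_sum)
  then show "(\<Sum>x\<in>V. (mv x)\<^sup>2) \<le> (\<Sum>x\<in>V. K x x) * (\<Sum>x\<in>V. f x * mv x)"
    unfolding quad by (simp add: K_def power2_eq_square sum_distrib_right)
qed

section \<open>The trace bound\<close>

lemma trace_cube_le:
  fixes S :: "'a \<Rightarrow> 'a \<Rightarrow> real"
  assumes fin: "finite V" and sym: "\<And>x y. S x y = S y x" and bound: "\<And>x y. \<bar>S x y\<bar> \<le> 1"
  defines "M \<equiv> \<lambda>x y. \<Sum>z\<in>V. (1 + S x z) * (1 - S z y)"
  shows "(\<Sum>x\<in>V. \<Sum>y\<in>V. \<Sum>z\<in>V. M x y * M y z * M z x) \<le> real (card V) ^ 6"
proof (cases "V = {}")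
  case False
  define n where "n = real (card V)"
  have n: "n > 0"
    using False fin by (simp add: n_def card_gt_0_iff)
  define d where "d x = (\<Sum>z\<in>V. S x z)" for x
  \<comment> \<open>Centring the columns of \<open>S\<close> makes them orthogonal to the constants,
    so that S^2 - d d^T / n appears as the Gram matrix L^T L.\<close>
  define L where "L z x = S z x - d x / n" for z x
  define K where "K x y = (\<Sum>z\<in>V. L z x * L z y)" for x y
  define mv where "mv f x = (\<Sum>y\<in>V. K x y * f y)" for f x
  define a where "a x = n + d x" for x
  define b where "b x = 1 - d x / n" for x
  define D where "D = (\<Sum>x\<in>V. (d x)\<^sup>2)"
  define E where "E = n\<^sup>2 - D / n"
  have dcol: "(\<Sum>z\<in>V. S z x) = d x" for x
    unfolding d_def by (simp add: sym)
  have K_eq: "K x y = (\<Sum>z\<in>V. S z x * S z y) - d x * d y / n" for x y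
  proof -
    have "K x y = (\<Sum>z\<in>V. S z x * S z y) - (\<Sum>z\<in>V. S z x) * d y / n - (\<Sum>z\<in>V. S z y) * d x / n
        + n * (d x * d y / n\<^sup>2)"
      by (simp add: K_def L_def algebra_simps sum.distrib sum_subtractf sum_distrib_left
          sum_distrib_right sum_divide_distrib n_def power2_eq_square)
    also have "n * (d x * d y / n\<^sup>2) = d x * d y / n"
      using n by (simp add: power2_eq_square)
    finally show ?thesis
      by (simp add: dcol mult.commute)
  qed
  have K_sym: "K x y = K y x" for x y
    by (simp add: K_def mult.commute)
  have M_eq: "M x y = a x * b y - K x y" for x y
  proof -
    have "M x y = n - (\<Sum>z\<in>V. S z y) + (\<Sum>z\<in>V. S x z) - (\<Sum>z\<in>V. S x z * S z y)"
      by (simp add: M_def algebra_simps sum.distrib sum_subtractf n_def)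
    also have "\<dots> = n - d y + d x - (\<Sum>z\<in>V. S z x * S z y)"
      unfolding dcol by (simp add: d_def sym[of x])
    also have "\<dots> = a x * b y - K x y"
      using n by (simp add: a_def b_def K_eq field_simps)
    finally show ?thesis .
  qed
  have C: "(\<Sum>x\<in>V. b x * a x) = E"
  proof -
    have "(\<Sum>x\<in>V. b x * a x) = (\<Sum>x\<in>V. n - (d x)\<^sup>2 / n)"
      using n by (intro sum.cong refl) (simp add: a_def b_def field_simps power2_eq_square)
    then show ?thesis
      by (simp add: E_def D_def sum_subtractf sum_divide_distrib power2_eq_square n_def)
  qed
  have trK: "(\<Sum>x\<in>V. K x x) \<le> E"
  proof -
    have "(\<Sum>x\<in>V. \<Sum>z\<in>V. S z x * S z x) \<le> (\<Sum>x\<in>V. \<Sum>z\<in>V. 1)"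
      using bound by (intro sum_mono) (simp add: abs_square_le_1 flip: power2_eq_square)
    then show ?thesis
      by (simp add: K_eq E_def D_def sum_subtractf sum_divide_distrib power2_eq_square n_def)
  qed
  have trK_nonneg: "0 \<le> (\<Sum>x\<in>V. K x x)"
    by (simp add: K_def sum_nonneg)
  have E: "0 \<le> E"
    using trK trK_nonneg by linarith
  \<comment> \<open>As \<open>a\<close> = n + d and n \<open>b\<close> = n - d, both forms below are
    differences of squares: the mixed terms cancel in \<open>Q\<close> by symmetry of
    \<open>K\<close>, and pointwise in \<open>W\<close>.\<close>
  have mv_lin: "mv a x = n * mv (\<lambda>_. 1) x + mv d x" "mv b x = mv (\<lambda>_. 1) x - mv d x / n" for x
    by (simp_all add: mv_def a_def b_def algebra_simps sum.distrib sum_subtractf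
        sum_distrib_left sum_divide_distrib)
  define k1 where "k1 = (\<Sum>x\<in>V. mv (\<lambda>_. 1) x)"
  define k2 where "k2 = (\<Sum>x\<in>V. (mv (\<lambda>_. 1) x)\<^sup>2)"
  define m where "m = (\<Sum>x\<in>V. d x * mv d x)"
  define w where "w = (\<Sum>x\<in>V. (mv d x)\<^sup>2)"
  have cross: "(\<Sum>x\<in>V. mv d x) = (\<Sum>x\<in>V. d x * mv (\<lambda>_. 1) x)"
  proof -
    have "(\<Sum>x\<in>V. mv d x) = (\<Sum>y\<in>V. \<Sum>x\<in>V. K x y * d y)"
      unfolding mv_def by (rule sum.swap)
    then show ?thesis
      by (simp add: mv_def sum_distrib_left K_sym mult.commute)
  qed
  have Q: "(\<Sum>x\<in>V. b x * mv a x) = n * k1 - m / n"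
  proof -
    have "b x * mv a x = n * mv (\<lambda>_. 1) x + mv d x - d x * mv (\<lambda>_. 1) x - d x * mv d x / n" for x
      using n by (simp add: mv_lin b_def field_simps)
    then show ?thesis
      by (simp add: sum.distrib sum_subtractf cross k1_def m_def sum_distrib_left sum_divide_distrib)
  qed
  have W: "(\<Sum>x\<in>V. mv b x * mv a x) = n * k2 - w / n"
  proof -
    have "mv b x * mv a x = n * (mv (\<lambda>_. 1) x)\<^sup>2 - (mv d x)\<^sup>2 / n" for x
      using n by (simp add: mv_lin field_simps power2_eq_square)
    then show ?thesis
      by (simp add: sum_subtractf k2_def w_def sum_distrib_left sum_divide_distrib)
  qed
  \<comment> \<open>The Gram inequality at the constant vector; 0 \<le> \<open>k1\<close> allows tr
    K to be replaced by the larger \<open>E\<close>.\<close>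
  have "k2 \<le> (\<Sum>x\<in>V. K x x) * k1" "0 \<le> k1"
    using gram_mult_norm_le[where V = V and L = L and f = "\<lambda>_. 1"]
    by (simp_all add: k1_def k2_def mv_def K_def)
  then have k: "k2 \<le> E * k1"
    using trK by (meson mult_right_mono order_trans)
  \<comment> \<open>The shift \<open>E / 2\<close> is what makes the mixed term of the square equal
    to \<open>E * m\<close>.\<close>
  have "0 \<le> (\<Sum>x\<in>V. (mv d x - E / 2 * d x)\<^sup>2)"
    by (simp add: sum_nonneg)
  also have "\<dots> = w - E * m + E\<^sup>2 / 4 * D"
    by (simp add: w_def m_def D_def power2_eq_square algebra_simps sum.distrib sum_subtractf
        sum_distrib_left sum_divide_distrib)
  finally have m: "E * m - w \<le> E\<^sup>2 / 4 * D"
    by simp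
  \<comment> \<open>The term -tr K^3 is discarded, being nonpositive.\<close>
  have "(\<Sum>x\<in>V. \<Sum>y\<in>V. \<Sum>z\<in>V. M x y * M y z * M z x)
      \<le> E ^ 3 - 3 * E * (n * k1 - m / n) + 3 * (n * k2 - w / n)"
    using trace_cube_rank_one_minus[OF K_sym, where V = V and a = a and b = b]
      trace_cube_gram_nonneg[where V = V and L = L]
    by (simp add: M_eq C Q[unfolded mv_def] W[unfolded mv_def] flip: K_def)
  also have "\<dots> = E ^ 3 + 3 * n * (k2 - E * k1) + 3 / n * (E * m - w)"
    by (simp add: algebra_simps diff_divide_distrib)
  also have "\<dots> \<le> E ^ 3 + 3 * n * 0 + 3 / n * (E\<^sup>2 / 4 * D)"
    using n k m by (intro add_mono mult_left_mono) auto
  also have "\<dots> = E\<^sup>2 * (E + 3 / 4 * (D / n))"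
    by (simp add: algebra_simps power2_eq_square power3_eq_cube)
  \<comment> \<open>Here \<open>E\<close> = n^2 - D/n: the first factor uses \<open>E\<close> \<le>
    n^2, and in the second the loss D/n outweighs the gain of 3/4 of it.\<close>
  also have "\<dots> \<le> (n\<^sup>2)\<^sup>2 * n\<^sup>2"
  proof -
    have "0 \<le> D / n"
      using n by (simp add: D_def sum_nonneg)
    with E show ?thesis
      by (intro mult_mono power_mono) (auto simp: E_def)
  qed
  finally show ?thesis
    by (simp add: n_def flip: power_mult power_add)
qed simp

section \<open>Counting alternating 6-cycles by a trace\<close>

text \<open>Once vertices 0, 2, 4 go to \<open>x\<close>, \<open>y\<close>, \<open>z\<close>, the
  images of 1, 3, 5 lie in \<open>A x y\<close>, \<open>A y z\<close>, \<open>A z x\<close>.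
  Forgetting injectivity and weakening blue to non-red only enlarges the count; 64 = 4^3 scales the
  three cardinalities to entries of the matrix in \<open>trace_cube_le\<close>.\<close>

lemma hom_inj_C6A_le:
  fixes G :: "'a ecgraph"
  assumes "edge_coloured_graph G"
  shows "64 * real (hom_inj C6A G) \<le> real (order G) ^ 6"
proof -
  define V where "V = verts G"
  define red where "red x y \<longleftrightarrow> {x, y} \<in> edges G \<and> col G {x, y} = Red" for x y
  define A where "A x y = {z \<in> V. red x z \<and> \<not> red z y}" for x y
  define T where "T = (SIGMA x:V. SIGMA y:V. SIGMA z:V. A x y \<times> A y z \<times> A z x)"
  define S :: "'a \<Rightarrow> 'a \<Rightarrow> real" where "S x y = (if red x y then 1 else - 1)" for x y
  have fin: "finite V"
    using assms by (simp add: V_def edge_coloured_graph_def)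
  then have finA: "finite (A x y)" for x y
    by (simp add: A_def)
  have col: "col C6A {0, 1} = Red" "col C6A {2, 3} = Red" "col C6A {4, 5} = Red"
      "col C6A {1, 2} = Blue" "col C6A {3, 4} = Blue" "col C6A {5, 0} = Blue"
    by (simp_all add: C6A_def doubleton_eq_iff)
  have verts6: "verts C6A = {0, 1, 2, 3, 4, 5}"
    by (auto simp: C6A_def)
  let ?F = "\<lambda>f :: nat \<Rightarrow> 'a. (f 0, f 2, f 4, f 1, f 3, f 5)"
  have inj: "inj_on ?F (homs C6A G)"
  proof (rule inj_onI)
    fix f g assume "f \<in> homs C6A G" "g \<in> homs C6A G" and eq: "?F f = ?F g"
    then have "f \<in> verts C6A \<rightarrow>\<^sub>E verts G" "g \<in> verts C6A \<rightarrow>\<^sub>E verts G"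
      by (auto simp: homs_def)
    then show "f = g"
      by (rule PiE_ext) (use eq in \<open>auto simp: verts6\<close>)
  qed
  have sub: "?F ` homs C6A G \<subseteq> T"
  proof (rule image_subsetI)
    fix f assume f: "f \<in> homs C6A G"
    have V: "f i \<in> V" if "i \<in> verts C6A" for i
      using f that by (auto simp: homs_def V_def)
    have e: "{f u, f v} \<in> edges G \<and> col G {f u, f v} = col C6A {u, v}"
      if "{u, v} \<in> edges C6A" for u v
      using f that by (simp add: homs_def)
    have "red (f 0) (f 1)" "red (f 2) (f 3)" "red (f 4) (f 5)"
        "\<not> red (f 1) (f 2)" "\<not> red (f 3) (f 4)" "\<not> red (f 5) (f 0)"
      using e[of 0 1] e[of 2 3] e[of 4 5] e[of 1 2] e[of 3 4] e[of 5 0]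
      unfolding col by (simp_all add: C6A_edges red_def del: One_nat_def)
    then show "?F f \<in> T"
      using V by (simp add: T_def A_def verts6 del: One_nat_def)
  qed
  have finT: "finite T"
    using fin finA by (auto simp: T_def intro!: finite_SigmaI)
  \<comment> \<open>The default value 0 is harmless; otherwise a subset is counted, and finiteness
    of \<open>homs C6A G\<close> comes from its injection into \<open>T\<close>.\<close>
  have "hom_inj C6A G \<le> card (homs C6A G)"
    using finite_imageD[OF finite_subset[OF sub finT] inj]
    by (auto simp: hom_inj_def intro: card_mono)
  also have "\<dots> \<le> card T"
    using card_inj_on_le[OF inj sub finT] .
  finally have "64 * real (hom_inj C6A G) \<le> 64 * real (card T)"
    by simp
  also have "\<dots> = (\<Sum>x\<in>V. \<Sum>y\<in>V. \<Sum>z\<in>V.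
      (4 * real (card (A x y))) * (4 * real (card (A y z))) * (4 * real (card (A z x))))"
    using fin finA by (simp add: T_def card_SigmaI card_cartesian_product sum_distrib_left mult_ac)
  also have "(\<lambda>x y. 4 * real (card (A x y))) = (\<lambda>x y. \<Sum>z\<in>V. (1 + S x z) * (1 - S z y))"
  proof (intro ext)
    fix x y
    \<comment> \<open>Each factor is 0 or 2, and both are 2 exactly on \<open>A x y\<close>.\<close>
    have "(\<Sum>z\<in>V. (1 + S x z) * (1 - S z y)) = (\<Sum>z\<in>V. if z \<in> A x y then 4 else 0)"
      by (intro sum.cong) (auto simp: A_def S_def)
    also have "\<dots> = (\<Sum>z\<in>A x y. 4)"
      using fin by (simp add: A_def flip: sum.inter_filter)
    finally show "4 * real (card (A x y)) = (\<Sum>z\<in>V. (1 + S x z) * (1 - S z y))"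
      by simp
  qed
  also have "(\<Sum>x\<in>V. \<Sum>y\<in>V. \<Sum>z\<in>V. (\<Sum>v\<in>V. (1 + S x v) * (1 - S v y))
      * (\<Sum>v\<in>V. (1 + S y v) * (1 - S v z)) * (\<Sum>v\<in>V. (1 + S z v) * (1 - S v x)))
      \<le> real (card V) ^ 6"
    using fin by (rule trace_cube_le) (auto simp: S_def red_def insert_commute)
  finally show ?thesis
    by (simp add: V_def order_def)
qed

section \<open>Normalisation and the limit\<close>

lemma falling_factorial_6_ratio_tendsto:
  "(\<lambda>n. fact (n - 6) / fact n * real n ^ 6 / 64) \<longlonglongrightarrow> 1 / 64"
proof -
  have "(\<lambda>n. real n ^ 6 /
      (real n * (real n - 1) * (real n - 2) * (real n - 3) * (real n - 4) * (real n - 5)) / 64)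
      \<longlonglongrightarrow> 1 / 64"
    by real_asymp
  moreover have "eventually (\<lambda>n. real n ^ 6 /
      (real n * (real n - 1) * (real n - 2) * (real n - 3) * (real n - 4) * (real n - 5)) / 64
      = fact (n - 6) / fact n * real n ^ 6 / 64) sequentially"
    \<comment> \<open>Below 6 the natural subtraction \<open>n - 6\<close> truncates, so the product
      formula is used only from 6 on.\<close>
    using eventually_ge_at_top[of 6]
  proof eventually_elim
    case (elim n)
    then obtain k where "n = k + 6"
      by (metis le_add_diff_inverse2)
    moreover have "fact (k + 6) = (fact k *
        ((real k + 6) * (real k + 5) * (real k + 4) * (real k + 3) * (real k + 2) * (real k + 1)))"
      by (simp add: numeral_eq_Suc algebra_simps)
    ultimately show ?case
      by (simp add: add.commute)
  qed
  ultimately show ?thesis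
    by (rule Lim_transform_eventually)
qed

theorem theorem2:
  shows "\<forall>\<epsilon>::real. \<epsilon> > 0 \<longrightarrow>
    (\<exists>n\<^sub>0::nat. \<forall>G :: 'a ecgraph. edge_coloured_graph G \<and> order G \<ge> n\<^sub>0 \<longrightarrow>
      t_inj C6A G \<le> (1 / 2) ^ 6 + \<epsilon>)"
proof (intro allI impI)
  fix \<epsilon> :: real assume "\<epsilon> > 0"
  moreover have "(1 / 2) ^ 6 = (1 / 64 :: real)"
    by (simp add: power_divide)
  ultimately have "eventually (\<lambda>n. fact (n - 6) / fact n * real n ^ 6 / 64 < (1 / 2) ^ 6 + \<epsilon>) sequentially"
    using falling_factorial_6_ratio_tendsto by (intro order_tendstoD(2)) auto
  \<comment> \<open>The bound sees a graph only through its order, so one threshold serves all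
    graphs.\<close>
  then obtain n\<^sub>0 where n\<^sub>0:
      "\<And>n. n \<ge> n\<^sub>0 \<Longrightarrow> fact (n - 6) / fact n * real n ^ 6 / 64 < (1 / 2) ^ 6 + \<epsilon>"
    by (auto simp: eventually_sequentially)
  have "t_inj C6A G \<le> (1 / 2) ^ 6 + \<epsilon>"
    if G: "edge_coloured_graph G" and large: "order G \<ge> n\<^sub>0" for G :: "'a ecgraph"
  proof -
    have "order C6A = 6"
      by (simp add: order_def C6A_def)
    then have "t_inj C6A G = fact (order G - 6) / fact (order G) * real (hom_inj C6A G)"
      by (simp add: t_inj_def)
    also have "\<dots> \<le> fact (order G - 6) / fact (order G) * (real (order G) ^ 6 / 64)"
      using hom_inj_C6A_le[OF G] by (intro mult_left_mono) auto
    also have "\<dots> \<le> (1 / 2) ^ 6 + \<epsilon>"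
      using n\<^sub>0[OF large] by simp
    finally show ?thesis .
  qed
  then show "\<exists>n\<^sub>0. \<forall>G :: 'a ecgraph. edge_coloured_graph G \<and> order G \<ge> n\<^sub>0 \<longrightarrow>
      t_inj C6A G \<le> (1 / 2) ^ 6 + \<epsilon>"
    by blast
qed

end
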